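(* The diagonals of a quadrilateral made of confocal spherical conics (in the unit sphere $\mathbb{S}^2$) or of confocal hyperbolic conics (in the hyperbolic plane) are equal.
   Context: Confocal spherical conics: fix $a>b>c$. They are the intersections of the unit sphere $x^2+y^2+z^2=1$ in $\mathbb{R}^3$ with the quadratic cones $\frac{x^2}{a-\lambda}+\frac{y^2}{b-\lambda}+\frac{z^2}{c-\lambda}=0$, $a>\lambda>c$, where $\lambda$ is the parameter in the family. Confocal hyperbolic conics: the hyperbolic plane is realized as the pseudosphere $x^2+y^2-z^2=-1$ (one sheet) in the pseudo-Euclidean space $\mathbb{R}^{2,1}$. Fix distinct $a,b,c$. The confocal conics are the intersections of the pseudosphere with the quadratic cones $\frac{x^2}{a-\lambda}+\frac{y^2}{b-\lambda}-\frac{z^2}{c-\lambda}=0$, where $\lambda$ is the parameter. In each case the confocal conics form an orthogonal net consisting of two subfamilies. A quadrilateral made of confocal conics has one pair of opposite sides on conics of one subfamily and the other pair of opposite sides on conics of the other subfamily. Its diagonals are the geodesic segments (in the spherical, respectively hyperbolic, metric) joining opposite vertices; "equal" means of equal length.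
   Formalization: The quadrilateral is taken to bound an embedded disc containing no focus of the confocal family; without this the claim fails, since a quadrilateral of four conic arcs enclosing one focus (with one reentrant corner) has unequal diagonals. *)

theory Defs
  imports "HOL-Analysis.Analysis"
begin

text \<open>
  \<open>net_quadrilateral M \<Lambda> K A B C D\<close>: in the surface \<open>M\<close> there is an embedded closed disc (the image
  of the unit square) whose boundary is divided by the consecutive vertices \<open>A, B, C, D\<close> into four
  sides, each an arc of a curve \<open>K \<mu>\<close> with \<open>\<mu> \<in> \<Lambda>\<close>. The subfamilies are the connected components
  of the parameter set \<open>\<Lambda>\<close>; the opposite sides \<open>AB\<close>, \<open>DC\<close> lie on curves of one subfamily, the opposite
  sides \<open>BC\<close>, \<open>AD\<close> on curves of another one. Opposite sides may lie on the same curve.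
\<close>

definition net_quadrilateral ::
  "(real^3) set \<Rightarrow> real set \<Rightarrow> (real \<Rightarrow> (real^3) set) \<Rightarrow>
   real^3 \<Rightarrow> real^3 \<Rightarrow> real^3 \<Rightarrow> real^3 \<Rightarrow> bool"
  where
  "net_quadrilateral M \<Lambda> K A B C D \<longleftrightarrow>
    (\<exists>F :: real \<times> real \<Rightarrow> real^3.
      continuous_on ({0..1} \<times> {0..1}) F \<and>
      inj_on F ({0..1} \<times> {0..1}) \<and>
      F ` ({0..1} \<times> {0..1}) \<subseteq> M \<and>
      F (0, 0) = A \<and> F (1, 0) = B \<and> F (1, 1) = C \<and> F (0, 1) = D \<and>
      (\<exists>I \<in> components \<Lambda>. \<exists>J \<in> components \<Lambda>. I \<noteq> J \<and>
        (\<exists>\<mu>\<in>I. F ` ({0..1} \<times> {0}) \<subseteq> K \<mu>) \<and>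
        (\<exists>\<mu>\<in>I. F ` ({0..1} \<times> {1}) \<subseteq> K \<mu>) \<and>
        (\<exists>\<nu>\<in>J. F ` ({0} \<times> {0..1}) \<subseteq> K \<nu>) \<and>
        (\<exists>\<nu>\<in>J. F ` ({1} \<times> {0..1}) \<subseteq> K \<nu>)))"


text \<open>
  Lengths of the diagonals are expressed by the geodesic distance, which is the length of a shortest
  great circle arc \<open>t \<mapsto> cos t *\<^sub>R P + sin t *\<^sub>R V\<close> from \<open>P\<close> to \<open>Q\<close> and, in the hyperbolic plane, of the
  geodesic segment \<open>t \<mapsto> cosh t *\<^sub>R P + sinh t *\<^sub>R V\<close>, with \<open>V\<close> a unit vector orthogonal to \<open>P\<close>.
\<close>

definition spherical_dist :: "real^3 \<Rightarrow> real^3 \<Rightarrow> real"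
  where "spherical_dist P Q = arccos (P \<bullet> Q)"

definition spherical_conic :: "real \<Rightarrow> real \<Rightarrow> real \<Rightarrow> real \<Rightarrow> (real^3) set"
  where
  "spherical_conic a b c \<mu> =
    {P \<in> sphere 0 1.
      (P $ 1)\<^sup>2 / (a - \<mu>) + (P $ 2)\<^sup>2 / (b - \<mu>) + (P $ 3)\<^sup>2 / (c - \<mu>) = 0}"

text \<open>
  The foci are the points where the two conics of the net through a point merge: the equation of the
  cone, with denominators cleared, is quadratic in \<open>\<mu>\<close>, and at these points it has a double root, which
  for \<open>a > b > c\<close> can only be \<open>b\<close>. The confocal conics are a net on the complement of
  the foci only, and quadrilaterals of the net must not contain foci: around a focus there are discs
  bounded by four arcs of conics, alternately from the two subfamilies, with three right angles
  and one reentrant corner, and their diagonals differ. The remaining points of the plane \<open>y = 0\<close>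
  (the degenerate conic \<open>\<mu> = b\<close>) and of the other coordinate planes are allowed inside a quadrilateral.
\<close>

definition spherical_foci :: "real \<Rightarrow> real \<Rightarrow> real \<Rightarrow> (real^3) set"
  where
  "spherical_foci a b c =
    {P \<in> sphere 0 1. P $ 2 = 0 \<and> (P $ 1)\<^sup>2 / (a - b) + (P $ 3)\<^sup>2 / (c - b) = 0}"

definition spherical_conic_quadrilateral ::
  "real \<Rightarrow> real \<Rightarrow> real \<Rightarrow> real^3 \<Rightarrow> real^3 \<Rightarrow> real^3 \<Rightarrow> real^3 \<Rightarrow> bool"
  where
  "spherical_conic_quadrilateral a b c =
    net_quadrilateral (sphere 0 1 - spherical_foci a b c) ({c<..<a} - {b}) (spherical_conic a b c)"


definition lorentz :: "real^3 \<Rightarrow> real^3 \<Rightarrow> real"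
  where "lorentz P Q = P $ 1 * Q $ 1 + P $ 2 * Q $ 2 - P $ 3 * Q $ 3"

definition hyperbolic_plane :: "(real^3) set"
  where "hyperbolic_plane = {P. lorentz P P = -1 \<and> P $ 3 > 0}"

definition hyperbolic_dist :: "real^3 \<Rightarrow> real^3 \<Rightarrow> real"
  where "hyperbolic_dist P Q = arcosh (- lorentz P Q)"

definition hyperbolic_conic :: "real \<Rightarrow> real \<Rightarrow> real \<Rightarrow> real \<Rightarrow> (real^3) set"
  where
  "hyperbolic_conic a b c \<mu> =
    {P \<in> hyperbolic_plane.
      (P $ 1)\<^sup>2 / (a - \<mu>) + (P $ 2)\<^sup>2 / (b - \<mu>) - (P $ 3)\<^sup>2 / (c - \<mu>) = 0}"

text \<open>
  As on the sphere, but here the double root can be \<open>a\<close> or \<open>b\<close>, depending on the order of \<open>a, b, c\<close>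
  (it cannot be \<open>c\<close>, as \<open>z > 0\<close>). If \<open>c\<close> lies between \<open>a\<close> and \<open>b\<close>, there are no foci.
\<close>

definition hyperbolic_foci :: "real \<Rightarrow> real \<Rightarrow> real \<Rightarrow> (real^3) set"
  where
  "hyperbolic_foci a b c =
    {P \<in> hyperbolic_plane.
      P $ 1 = 0 \<and> (P $ 2)\<^sup>2 / (b - a) - (P $ 3)\<^sup>2 / (c - a) = 0 \<or>
      P $ 2 = 0 \<and> (P $ 1)\<^sup>2 / (a - b) - (P $ 3)\<^sup>2 / (c - b) = 0}"

text \<open>
  Of the four components of the parameter set exactly two contain parameters of nonempty conics,
  for each of the possible orders of \<open>a, b, c\<close>.
\<close>

definition hyperbolic_conic_quadrilateral ::
  "real \<Rightarrow> real \<Rightarrow> real \<Rightarrow> real^3 \<Rightarrow> real^3 \<Rightarrow> real^3 \<Rightarrow> real^3 \<Rightarrow> bool"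
  where
  "hyperbolic_conic_quadrilateral a b c =
    net_quadrilateral (hyperbolic_plane - hyperbolic_foci a b c) (UNIV - {a, b, c})
      (hyperbolic_conic a b c)"

end

theory Submission imports Defs begin

text \<open>
  The squared coordinates of a point on the conics with parameters \<open>\<lambda>\<close> and \<open>\<mu>\<close> are products of a
  function of \<open>\<lambda>\<close> and a function of \<open>\<mu>\<close>, for instance \<open>x\<^sup>2 = \<plusminus> (a - \<lambda>) (a - \<mu>) / ((a - b) (a - c))\<close>.
  Hence the diagonals satisfy \<open>x\<^sub>A x\<^sub>C = \<plusminus> x\<^sub>B x\<^sub>D\<close>, and likewise for \<open>y\<close> and \<open>z\<close>; only the signs matter.
  If \<open>a\<close> does not separate the two subfamilies, one of them consists of conics that do not meet
  the plane \<open>x = 0\<close>. If it does, \<open>(\<lambda> - a) - (a - \<mu>) + 2 \<i> k x\<close> with \<open>(k x)\<^sup>2 = (\<lambda> - a) (a - \<mu>)\<close> is a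
  polynomial in the coordinates that vanishes only at the foci, so on a disc without foci it has a
  continuous square root \<open>u + \<i> v\<close>. Then \<open>k x = u v\<close>, \<open>u\<^sup>2 = \<lambda> - a\<close> and \<open>v\<^sup>2 = a - \<mu>\<close>, so \<open>u\<close> keeps its
  sign along each side from one subfamily and \<open>v\<close> along each side from the other one.
\<close>

section \<open>Elliptic coordinates of a point on two conics of the family\<close>

lemma conic_clear_denominators:
  fixes a b c l X Y Z :: real
  assumes "X / (a - l) + Y / (b - l) + Z / (c - l) = 0" "l \<noteq> a" "l \<noteq> b" "l \<noteq> c"
  shows "X * (b - l) * (c - l) + Y * (a - l) * (c - l) + Z * (a - l) * (b - l) = 0"
proof -
  have "X * e * f + Y * d * f + Z * d * e = 0"
    if "X / d + Y / e + Z / f = 0" "d \<noteq> 0" "e \<noteq> 0" "f \<noteq> 0" for d e f :: real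
    using that by (simp add: field_simps)
  from this[OF assms(1)] show ?thesis
    using assms(2-4) by simp
qed

text \<open>Since \<open>X + Y + Z = 1\<close>, the cone equation with cleared denominators is a
  monic quadratic in the parameter. Its roots are \<open>l\<close> and \<open>m\<close>; evaluating
  it at \<open>a\<close> gives the claim.\<close>

lemma elliptic_coordinate:
  fixes a b c l m X Y Z :: real
  assumes "X + Y + Z = 1"
    and "X / (a - l) + Y / (b - l) + Z / (c - l) = 0" "l \<noteq> a" "l \<noteq> b" "l \<noteq> c"
    and "X / (a - m) + Y / (b - m) + Z / (c - m) = 0" "m \<noteq> a" "m \<noteq> b" "m \<noteq> c"
    and "l \<noteq> m"
  shows "X * ((a - b) * (a - c)) = (a - l) * (a - m)"
proof -
  have l: "X * (b - l) * (c - l) + Y * (a - l) * (c - l) + Z * (a - l) * (b - l) = 0"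
    using assms by (intro conic_clear_denominators)
  have m: "X * (b - m) * (c - m) + Y * (a - m) * (c - m) + Z * (a - m) * (b - m) = 0"
    using assms by (intro conic_clear_denominators)
  have "Z = 1 - X - Y"
    using assms(1) by simp
  with l m have "(l - m) * (X * ((a - b) * (a - c)) - (a - l) * (a - m)) = 0"
    by algebra
  then show ?thesis
    using \<open>l \<noteq> m\<close> by simp
qed

text \<open>For \<open>x = 0\<close>, quadric and cone give two linear equations with solution
  \<open>\<beta> * y\<^sup>2 = (b - l) / (b - c)\<close>, and similarly for \<open>z\<close>. So for
  every conic that meets this plane, the signs of \<open>b - l\<close> and \<open>c - l\<close> are
  dictated by \<beta>, \<gamma> and the order of \<open>b\<close> and \<open>c\<close>.\<close>

lemma conic_meets_coordinate_plane:
  fixes a b c l \<beta> \<gamma> y z :: real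
  assumes "\<beta> * y\<^sup>2 + \<gamma> * z\<^sup>2 = 1"
    and "\<beta> * y\<^sup>2 / (b - l) + \<gamma> * z\<^sup>2 / (c - l) = 0" "l \<noteq> b" "l \<noteq> c"
  shows "\<beta> * ((b - l) * (b - c)) \<ge> 0" "\<gamma> * ((c - l) * (c - b)) \<ge> 0"
proof -
  have "Y * f + Z * e = 0" if "Y / e + Z / f = 0" "e \<noteq> 0" "f \<noteq> 0" for Y Z e f :: real
    using that by (simp add: field_simps)
  from this[OF assms(2)] have eq: "\<beta> * y\<^sup>2 * (c - l) + \<gamma> * z\<^sup>2 * (b - l) = 0"
    using assms(3,4) by simp
  have "b - l = \<beta> * y\<^sup>2 * (b - c)"
    using eq assms(1) by algebra
  then have "\<beta> * ((b - l) * (b - c)) = (\<beta> * y * (b - c))\<^sup>2"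
    by (simp add: power2_eq_square)
  then show "\<beta> * ((b - l) * (b - c)) \<ge> 0"
    by simp
  have "c - l = \<gamma> * z\<^sup>2 * (c - b)"
    using eq assms(1) by algebra
  then have "\<gamma> * ((c - l) * (c - b)) = (\<gamma> * z * (c - b))\<^sup>2"
    by (simp add: power2_eq_square)
  then show "\<gamma> * ((c - l) * (c - b)) \<ge> 0"
    by simp
qed

lemma square_factor_pos:
  fixes d e w :: real
  assumes "d * w\<^sup>2 * e = r" "r > 0"
  shows "d * e > 0"
proof -
  have "w\<^sup>2 * (d * e) > 0"
    using assms by (simp add: ac_simps)
  then show ?thesis
    by (meson mult_le_0_iff not_le zero_le_power2)
qed

section \<open>Constancy of signs on connected sets\<close>

lemma components_same_side:
  fixes u v e :: real
  assumes "I \<in> components \<Lambda>" "e \<notin> \<Lambda>" "u \<in> I" "v \<in> I"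
  shows "(e - u) * (e - v) > 0"
proof -
  have "e \<notin> I" "connected I"
    using assms in_components_subset in_components_connected by blast+
  then have "(u < e \<longleftrightarrow> v < e)" "u \<noteq> e" "v \<noteq> e"
    using assms connectedD_interval[of I u v e] connectedD_interval[of I v u e]
    by (force simp: not_less)+
  then show ?thesis
    by (cases "u < e") (auto simp: zero_less_mult_iff)
qed

lemma continuous_nonvanishing_same_sign:
  fixes f :: "'a::topological_space \<Rightarrow> real"
  assumes "connected T" "continuous_on T f" "\<And>p. p \<in> T \<Longrightarrow> f p \<noteq> 0" "p \<in> T" "q \<in> T"
  shows "f p * f q > 0"
proof -
  have "connected (f ` T)"
    using assms(1,2) connected_continuous_image by blast
  then have "\<not> (f p \<le> 0 \<and> 0 \<le> f q)" "\<not> (f q \<le> 0 \<and> 0 \<le> f p)"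
    using assms(3-5) connectedD_interval[of "f ` T" "f p" "f q" 0]
      connectedD_interval[of "f ` T" "f q" "f p" 0] by force+
  then show ?thesis
    by (auto simp: zero_less_mult_iff not_le)
qed

lemma horizontal_side_sign:
  fixes f :: "real \<times> real \<Rightarrow> real"
  assumes "continuous_on ({0..1} \<times> {0..1}) f" "s \<in> {0..1}"
    and "\<And>t. t \<in> {0..1} \<Longrightarrow> f (t, s) \<noteq> 0"
  shows "f (0, s) * f (1, s) > 0"
proof (rule continuous_nonvanishing_same_sign[where T = "{0..1} \<times> {s}"])
  show "connected ({0..1::real} \<times> {s})"
    by (intro connected_Times) auto
  show "continuous_on ({0..1} \<times> {s}) f"
    using assms(1,2) by (auto intro: continuous_on_subset)
qed (use assms in auto)

lemma vertical_side_sign: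
  fixes f :: "real \<times> real \<Rightarrow> real"
  assumes "continuous_on ({0..1} \<times> {0..1}) f" "s \<in> {0..1}"
    and "\<And>t. t \<in> {0..1} \<Longrightarrow> f (s, t) \<noteq> 0"
  shows "f (s, 0) * f (s, 1) > 0"
proof (rule continuous_nonvanishing_same_sign[where T = "{s} \<times> {0..1}"])
  show "connected ({s} \<times> {0..1::real})"
    by (intro connected_Times) auto
  show "continuous_on ({s} \<times> {0..1}) f"
    using assms(1,2) by (auto intro: continuous_on_subset)
qed (use assms in auto)

section \<open>Signs of a coordinate at the four vertices\<close>

text \<open>
  The signs \<open>\<alpha>, \<beta>, \<gamma>\<close> are \<open>1, 1, 1\<close> on the sphere and \<open>-1, -1, 1\<close> in the hyperbolic plane. Horizontal
  sides of the unit square lie on the conics with parameters \<open>\<mu> 0\<close> and \<open>\<mu> 1\<close>, vertical sides on those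
  with parameters \<open>\<nu> 0\<close> and \<open>\<nu> 1\<close>. The assumptions are invariant under simultaneous permutations of
  \<open>x, y, z\<close> and \<open>a, b, c\<close> and \<open>\<alpha>, \<beta>, \<gamma>\<close>, so it suffices to treat \<open>x\<close>.
\<close>

locale confocal_square =
  fixes x y z :: "real \<times> real \<Rightarrow> real" and a b c \<alpha> \<beta> \<gamma> :: real and \<mu> \<nu> :: "real \<Rightarrow> real"
  assumes continuous: "continuous_on ({0..1} \<times> {0..1}) x" "continuous_on ({0..1} \<times> {0..1}) y"
      "continuous_on ({0..1} \<times> {0..1}) z"
    and distinct: "a \<noteq> b" "b \<noteq> c" "a \<noteq> c"
    and sign: "\<alpha> * \<beta> * \<gamma> > 0"
    and quadric: "\<And>p. p \<in> {0..1} \<times> {0..1} \<Longrightarrow> \<alpha> * (x p)\<^sup>2 + \<beta> * (y p)\<^sup>2 + \<gamma> * (z p)\<^sup>2 = 1"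
    and horizontal: "\<And>s t. s \<in> {0, 1} \<Longrightarrow> t \<in> {0..1} \<Longrightarrow>
      \<alpha> * (x (t, s))\<^sup>2 / (a - \<mu> s) + \<beta> * (y (t, s))\<^sup>2 / (b - \<mu> s) + \<gamma> * (z (t, s))\<^sup>2 / (c - \<mu> s) = 0"
    and vertical: "\<And>s t. s \<in> {0, 1} \<Longrightarrow> t \<in> {0..1} \<Longrightarrow>
      \<alpha> * (x (s, t))\<^sup>2 / (a - \<nu> s) + \<beta> * (y (s, t))\<^sup>2 / (b - \<nu> s) + \<gamma> * (z (s, t))\<^sup>2 / (c - \<nu> s) = 0"
    and \<mu>_side: "\<And>e s t. e \<in> {a, b, c} \<Longrightarrow> s \<in> {0, 1} \<Longrightarrow> t \<in> {0, 1} \<Longrightarrow> (e - \<mu> s) * (e - \<mu> t) > 0"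
    and \<nu>_side: "\<And>e s t. e \<in> {a, b, c} \<Longrightarrow> s \<in> {0, 1} \<Longrightarrow> t \<in> {0, 1} \<Longrightarrow> (e - \<nu> s) * (e - \<nu> t) > 0"
    and \<mu>_neq_\<nu>: "\<And>s t. s \<in> {0, 1} \<Longrightarrow> t \<in> {0, 1} \<Longrightarrow> \<mu> s \<noteq> \<nu> t"
begin

lemma \<mu>_neq: "s \<in> {0, 1} \<Longrightarrow> \<mu> s \<noteq> a \<and> \<mu> s \<noteq> b \<and> \<mu> s \<noteq> c"
  using \<mu>_side[of a s s] \<mu>_side[of b s s] \<mu>_side[of c s s] by auto

lemma \<nu>_neq: "s \<in> {0, 1} \<Longrightarrow> \<nu> s \<noteq> a \<and> \<nu> s \<noteq> b \<and> \<nu> s \<noteq> c"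
  using \<nu>_side[of a s s] \<nu>_side[of b s s] \<nu>_side[of c s s] by auto

text \<open>The vertex \<open>(s, t)\<close> lies on the horizontal side at height \<open>t\<close>
  and on the vertical side at abscissa \<open>s\<close>, hence the crossed indices.\<close>

lemma vertex:
  assumes "s \<in> {0, 1}" "t \<in> {0, 1}"
  shows "\<alpha> * (x (s, t))\<^sup>2 * ((a - b) * (a - c)) = (a - \<mu> t) * (a - \<nu> s)"
proof (rule elliptic_coordinate)
  have "(s, t) \<in> {0..1} \<times> {0..1}" "s \<in> {0..1}" "t \<in> {0..1}"
    using assms by auto
  then show "\<alpha> * (x (s, t))\<^sup>2 + \<beta> * (y (s, t))\<^sup>2 + \<gamma> * (z (s, t))\<^sup>2 = 1"
    "\<alpha> * (x (s, t))\<^sup>2 / (a - \<mu> t) + \<beta> * (y (s, t))\<^sup>2 / (b - \<mu> t) + \<gamma> * (z (s, t))\<^sup>2 / (c - \<mu> t) = 0"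
    "\<alpha> * (x (s, t))\<^sup>2 / (a - \<nu> s) + \<beta> * (y (s, t))\<^sup>2 / (b - \<nu> s) + \<gamma> * (z (s, t))\<^sup>2 / (c - \<nu> s) = 0"
    using quadric horizontal vertical assms by blast+
qed (use assms \<mu>_neq \<nu>_neq \<mu>_neq_\<nu> in auto)

lemma rotate: "confocal_square y z x b c a \<beta> \<gamma> \<alpha> \<mu> \<nu>"
proof
  show "\<beta> * \<gamma> * \<alpha> > 0"
    using sign by (simp add: ac_simps)
  show "\<beta> * (y p)\<^sup>2 + \<gamma> * (z p)\<^sup>2 + \<alpha> * (x p)\<^sup>2 = 1" if "p \<in> {0..1} \<times> {0..1}" for p
    using quadric[OF that] by simp
  show "\<beta> * (y (t, s))\<^sup>2 / (b - \<mu> s) + \<gamma> * (z (t, s))\<^sup>2 / (c - \<mu> s) + \<alpha> * (x (t, s))\<^sup>2 / (a - \<mu> s) = 0"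
    if "s \<in> {0, 1}" "t \<in> {0..1}" for s t
    using horizontal[OF that] by simp
  show "\<beta> * (y (s, t))\<^sup>2 / (b - \<nu> s) + \<gamma> * (z (s, t))\<^sup>2 / (c - \<nu> s) + \<alpha> * (x (s, t))\<^sup>2 / (a - \<nu> s) = 0"
    if "s \<in> {0, 1}" "t \<in> {0..1}" for s t
    using vertical[OF that] by simp
qed (use continuous distinct \<mu>_side \<nu>_side \<mu>_neq_\<nu> in auto)

lemma coordinate_square: "(x (0, 0) * x (1, 1))\<^sup>2 = (x (1, 0) * x (0, 1))\<^sup>2"
proof -
  let ?k = "\<alpha> * ((a - b) * (a - c))"
  have "?k \<noteq> 0"
    using sign distinct by auto
  have v: "?k * (x (s, t))\<^sup>2 = (a - \<mu> t) * (a - \<nu> s)" if "s \<in> {0, 1}" "t \<in> {0, 1}" for s t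
    using vertex[OF that] by (simp add: ac_simps)
  have "?k * ?k * (x (0, 0) * x (1, 1))\<^sup>2 = (?k * (x (0, 0))\<^sup>2) * (?k * (x (1, 1))\<^sup>2)"
    by (simp add: power_mult_distrib)
  \<comment> \<open>Each diagonal collects the same four factors, one from each side of the
    square.\<close>
  also have "\<dots> = (?k * (x (1, 0))\<^sup>2) * (?k * (x (0, 1))\<^sup>2)"
    by (simp add: v)
  also have "\<dots> = ?k * ?k * (x (1, 0) * x (0, 1))\<^sup>2"
    by (simp add: power_mult_distrib)
  finally show ?thesis
    using \<open>?k \<noteq> 0\<close> by simp
qed

text \<open>Otherwise \<open>x\<close> vanishes somewhere on a horizontal and somewhere on a
  vertical side. Both conics then meet the plane \<open>x = 0\<close>, so neither \<open>b\<close>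
  nor \<open>c\<close> separates them, just as \<open>a\<close> does not. The signs this forces at
  their common vertex contradict \<alpha> * \<beta> * \<gamma> > 0.\<close>

lemma sign_if_not_separating:
  assumes "(a - \<mu> 0) * (a - \<nu> 0) > 0"
  shows "x (0, 0) * x (1, 0) * x (1, 1) * x (0, 1) > 0"
proof (rule ccontr)
  assume neg: "\<not> ?thesis"
  \<comment> \<open>The corners can be paired along the horizontal or along the vertical sides, so a
    zero is needed on a side of each kind.\<close>
  have *: "x (0, 0) * x (1, 0) * x (1, 1) * x (0, 1) > 0"
    if "x (0, 0) * x (1, 0) > 0 \<and> x (0, 1) * x (1, 1) > 0 \<or>
      x (0, 0) * x (0, 1) > 0 \<and> x (1, 0) * x (1, 1) > 0"
    using that mult_pos_pos[of "x (0, 0) * x (1, 0)" "x (0, 1) * x (1, 1)"]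
      mult_pos_pos[of "x (0, 0) * x (0, 1)" "x (1, 0) * x (1, 1)"] by (auto simp: ac_simps)
  have "\<exists>s\<in>{0, 1}. \<exists>p\<in>{0..1}. x (p, s) = 0"
  proof (rule ccontr)
    assume "\<not> ?thesis"
    then have "x (0, s) * x (1, s) > 0" if "s \<in> {0, 1}" for s
      using that by (intro horizontal_side_sign continuous) auto
    then show False
      using neg * by simp
  qed
  then obtain s p where s: "s \<in> {0, 1}" "p \<in> {0..1}" "x (p, s) = 0"
    by blast
  have "\<exists>s\<in>{0, 1}. \<exists>p\<in>{0..1}. x (s, p) = 0"
  proof (rule ccontr)
    assume "\<not> ?thesis"
    then have "x (s, 0) * x (s, 1) > 0" if "s \<in> {0, 1}" for s
      using that by (intro vertical_side_sign continuous) auto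
    then show False
      using neg * by simp
  qed
  then obtain r q where r: "r \<in> {0, 1}" "q \<in> {0..1}" "x (r, q) = 0"
    by blast
  have ps: "(p, s) \<in> {0..1} \<times> {0..1}" and rq: "(r, q) \<in> {0..1} \<times> {0..1}"
    using s r by auto
  have \<mu>: "\<beta> * ((b - \<mu> s) * (b - c)) \<ge> 0" "\<gamma> * ((c - \<mu> s) * (c - b)) \<ge> 0"
    using quadric[OF ps] horizontal[OF s(1,2)] s(3) \<mu>_neq[OF s(1)]
    by (intro conic_meets_coordinate_plane[of \<beta> "y (p, s)" \<gamma> "z (p, s)"]; simp)+
  have \<nu>: "\<beta> * ((b - \<nu> r) * (b - c)) \<ge> 0" "\<gamma> * ((c - \<nu> r) * (c - b)) \<ge> 0"
    using quadric[OF rq] vertical[OF r(1,2)] r(3) \<nu>_neq[OF r(1)]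
    by (intro conic_meets_coordinate_plane[of \<beta> "y (r, q)" \<gamma> "z (r, q)"]; simp)+
  have nonneg_cancel: "m * n \<ge> 0"
    if "d * (m * e) \<ge> 0" "d * (n * e) \<ge> 0" "d \<noteq> 0" "e \<noteq> 0" for d e m n :: real
  proof -
    have "(d * e)\<^sup>2 * (m * n) \<ge> 0"
      using mult_nonneg_nonneg[OF that(1,2)] by (simp add: power2_eq_square ac_simps)
    then show ?thesis
      using that(3,4) by (simp add: zero_le_mult_iff)
  qed
  have nz: "\<alpha> \<noteq> 0" "\<beta> \<noteq> 0" "\<gamma> \<noteq> 0"
    using sign by auto
  have "(a - \<mu> s) * (a - \<nu> r) > 0"
    using assms \<mu>_side[of a 0 s] \<nu>_side[of a 0 r] s r
    by (auto simp: zero_less_mult_iff)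
  moreover have "(b - \<mu> s) * (b - \<nu> r) > 0"
    using nonneg_cancel[OF \<mu>(1) \<nu>(1)] nz distinct \<mu>_neq[OF s(1)] \<nu>_neq[OF r(1)]
    by (auto simp: less_le)
  moreover have "(c - \<mu> s) * (c - \<nu> r) > 0"
    using nonneg_cancel[OF \<mu>(2) \<nu>(2)] nz distinct \<mu>_neq[OF s(1)] \<nu>_neq[OF r(1)]
    by (auto simp: less_le)
  ultimately have "\<alpha> * ((a - b) * (a - c)) > 0" "\<beta> * ((b - c) * (b - a)) > 0"
      "\<gamma> * ((c - a) * (c - b)) > 0"
    using vertex[OF r(1) s(1)] confocal_square.vertex[OF rotate r(1) s(1)]
      confocal_square.vertex[OF confocal_square.rotate[OF rotate] r(1) s(1)]
    by (blast intro: square_factor_pos)+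
  \<comment> \<open>Each difference of two of \<open>a\<close>, \<open>b\<close>, \<open>c\<close>
    occurs once in each orientation, so the product of all six is minus a square.\<close>
  then have "\<alpha> * ((a - b) * (a - c)) * (\<beta> * ((b - c) * (b - a))) * (\<gamma> * ((c - a) * (c - b))) > 0"
    by (intro mult_pos_pos[OF mult_pos_pos])
  also have "\<dots> = - (\<alpha> * \<beta> * \<gamma> * ((a - b) * (b - c) * (c - a))\<^sup>2)"
    by algebra
  also have "\<dots> \<le> 0"
    using sign by simp
  finally show False
    by simp
qed

lemma sign_if_separating:
  assumes "(a - \<mu> 0) * (a - \<nu> 0) < 0"
    and no_focus: "\<And>p. p \<in> {0..1} \<times> {0..1} \<Longrightarrow> x p = 0 \<Longrightarrow>
      \<beta> * (y p)\<^sup>2 / (b - a) + \<gamma> * (z p)\<^sup>2 / (c - a) \<noteq> 0"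
  shows "x (0, 0) * x (1, 0) * x (1, 1) * x (0, 1) > 0"
proof -
  let ?S = "{0..1::real} \<times> {0..1::real}"
  \<comment> \<open>This scaling makes \<open>(k * x p)\<^sup>2\<close> minus the product of the two
    roots, measured from \<open>a\<close>.\<close>
  define k where "k = sqrt (- \<alpha> * ((a - b) * (a - c)))"
  \<comment> \<open>This is the sum of the roots measured from \<open>a\<close>: the cleared cone
    equation reads \<open>(l - a)\<^sup>2 - g p * (l - a) - (k * x p)\<^sup>2 = 0\<close>.\<close>
  define g where "g p = \<alpha> * (x p)\<^sup>2 * (b + c - 2 * a) + \<beta> * (y p)\<^sup>2 * (c - a)
    + \<gamma> * (z p)\<^sup>2 * (b - a)" for p
  have "- \<alpha> * (x (0, 0))\<^sup>2 * ((a - b) * (a - c)) = - ((a - \<mu> 0) * (a - \<nu> 0))"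
    using vertex[of 0 0] by simp
  with assms(1) have "- \<alpha> * ((a - b) * (a - c)) > 0"
    by (intro square_factor_pos[of "- \<alpha>" "x (0, 0)"]) auto
  then have k: "k > 0" "k\<^sup>2 = - \<alpha> * ((a - b) * (a - c))"
    by (auto simp: k_def)
  have cont_w: "continuous_on ?S (\<lambda>p. Complex (g p) (2 * k * x p))"
    unfolding g_def Complex_eq by (intro continuous_intros continuous)
  \<comment> \<open>The discriminant of this quadratic is
    \<open>(g p)\<^sup>2 + (2 * k * x p)\<^sup>2\<close>, the squared modulus of the complex number,
    so a zero means a double root, that is, a focus.\<close>
  have w_neq_0: "Complex (g p) (2 * k * x p) \<noteq> 0" if "p \<in> ?S" for p
  proof
    assume "Complex (g p) (2 * k * x p) = 0"
    then have "x p = 0" "\<beta> * (y p)\<^sup>2 * (c - a) + \<gamma> * (z p)\<^sup>2 * (b - a) = 0"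
      using k by (auto simp: g_def complex_eq_iff)
    then show False
      using no_focus[OF that] distinct by (simp add: field_simps)
  qed
  have "contractible ?S"
    by (intro convex_imp_contractible convex_Times) auto
  then obtain h where h: "continuous_on ?S h"
    "\<And>p. p \<in> ?S \<Longrightarrow> Complex (g p) (2 * k * x p) = (h p)\<^sup>2"
    using continuous_sqrt_on_contractible[OF cont_w _ w_neq_0] by blast
  define u v where "u p = Re (h p)" and "v p = Im (h p)" for p
  have cont: "continuous_on ?S u" "continuous_on ?S v"
    unfolding u_def v_def by (intro continuous_intros h)+
  have uv: "g p = (u p)\<^sup>2 - (v p)\<^sup>2" "k * x p = u p * v p" if "p \<in> ?S" for p
    using h(2)[OF that] by (auto simp: complex_eq_iff u_def v_def power2_eq_square)
  \<comment> \<open>Sum and product of the roots measured from \<open>a\<close> are now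
    \<open>(u p)\<^sup>2 - (v p)\<^sup>2\<close> and \<open>- (u p * v p)\<^sup>2\<close>, so the
    quadratic factors.\<close>
  have root: "(l - a - (u p)\<^sup>2) * (l - a + (v p)\<^sup>2) = 0"
    if "p \<in> ?S" "l \<noteq> a" "l \<noteq> b" "l \<noteq> c"
      "\<alpha> * (x p)\<^sup>2 / (a - l) + \<beta> * (y p)\<^sup>2 / (b - l) + \<gamma> * (z p)\<^sup>2 / (c - l) = 0" for p l
  proof -
    have "\<alpha> * (x p)\<^sup>2 * (b - l) * (c - l) + \<beta> * (y p)\<^sup>2 * (a - l) * (c - l)
        + \<gamma> * (z p)\<^sup>2 * (a - l) * (b - l) = 0"
      using that by (intro conic_clear_denominators)
    then have "(l - a)\<^sup>2 - g p * (l - a) - (k * x p)\<^sup>2 = 0"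
      using quadric[OF that(1)] k(2) unfolding g_def by algebra
    then show ?thesis
      unfolding uv[OF that(1)] by algebra
  qed
  \<comment> \<open>For \<open>l > a\<close> the second factor in \<open>root\<close> is positive,
    which leaves \<open>(u p)\<^sup>2 = l - a\<close>.\<close>
  have u: "u p \<noteq> 0"
    if "l > a" "p \<in> ?S" "l \<noteq> a" "l \<noteq> b" "l \<noteq> c"
      "\<alpha> * (x p)\<^sup>2 / (a - l) + \<beta> * (y p)\<^sup>2 / (b - l) + \<gamma> * (z p)\<^sup>2 / (c - l) = 0" for p l
  proof -
    have "l - a + (v p)\<^sup>2 > 0"
      using \<open>l > a\<close> by (intro add_pos_nonneg) auto
    then show ?thesis
      using root[OF that(2-)] \<open>l > a\<close> by auto
  qed
  have v: "v p \<noteq> 0"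
    if "l < a" "p \<in> ?S" "l \<noteq> a" "l \<noteq> b" "l \<noteq> c"
      "\<alpha> * (x p)\<^sup>2 / (a - l) + \<beta> * (y p)\<^sup>2 / (b - l) + \<gamma> * (z p)\<^sup>2 / (c - l) = 0" for p l
  proof -
    have "a - l + (u p)\<^sup>2 > 0"
      using \<open>l < a\<close> by (intro add_pos_nonneg) auto
    then show ?thesis
      using root[OF that(2-)] \<open>l < a\<close> by auto
  qed
  have sides: "(\<forall>s\<in>{0, 1}. \<forall>t\<in>{0..1}. u (t, s) \<noteq> 0 \<and> v (s, t) \<noteq> 0) \<or>
    (\<forall>s\<in>{0, 1}. \<forall>t\<in>{0..1}. v (t, s) \<noteq> 0 \<and> u (s, t) \<noteq> 0)"
  proof (cases "\<mu> 0 > a")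
    case True
    then have "\<mu> s > a" "\<nu> s < a" if "s \<in> {0, 1}" for s
      using assms(1) \<mu>_side[of a 0 s] \<nu>_side[of a 0 s] that
      by (auto simp: zero_less_mult_iff mult_less_0_iff)
    then have "u (t, s) \<noteq> 0 \<and> v (s, t) \<noteq> 0" if "s \<in> {0, 1}" "t \<in> {0..1}" for s t
      using that u[OF _ _ _ _ _ horizontal[OF that]] v[OF _ _ _ _ _ vertical[OF that]]
        \<mu>_neq[OF that(1)] \<nu>_neq[OF that(1)] by auto
    then show ?thesis
      by blast
  next
    case False
    then have "\<mu> s < a" "\<nu> s > a" if "s \<in> {0, 1}" for s
      using assms(1) \<mu>_side[of a 0 s] \<nu>_side[of a 0 s] that
      by (auto simp: zero_less_mult_iff mult_less_0_iff)
    then have "v (t, s) \<noteq> 0 \<and> u (s, t) \<noteq> 0" if "s \<in> {0, 1}" "t \<in> {0..1}" for s t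
      using that v[OF _ _ _ _ _ horizontal[OF that]] u[OF _ _ _ _ _ vertical[OF that]]
        \<mu>_neq[OF that(1)] \<nu>_neq[OF that(1)] by auto
    then show ?thesis
      by blast
  qed
  \<comment> \<open>One of \<open>u\<close>, \<open>v\<close> has constant sign along each
    horizontal side and the other along each vertical side, so either one has a positive product
    over the four corners.\<close>
  have "u (0, 0) * u (1, 0) * u (1, 1) * u (0, 1) * (v (0, 0) * v (1, 0) * v (1, 1) * v (0, 1)) > 0"
    using sides
  proof
    assume *: "\<forall>s\<in>{0, 1}. \<forall>t\<in>{0..1}. u (t, s) \<noteq> 0 \<and> v (s, t) \<noteq> 0"
    have pos: "u (0, 0) * u (1, 0) > 0" "u (0, 1) * u (1, 1) > 0"
      "v (0, 0) * v (0, 1) > 0" "v (1, 0) * v (1, 1) > 0"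
      using * by (intro horizontal_side_sign vertical_side_sign cont; simp)+
    have "(u (0, 0) * u (1, 0)) * (u (0, 1) * u (1, 1)) *
      ((v (0, 0) * v (0, 1)) * (v (1, 0) * v (1, 1))) > 0"
      by (intro mult_pos_pos[OF mult_pos_pos mult_pos_pos] pos)
    then show ?thesis
      by (simp add: ac_simps)
  next
    assume *: "\<forall>s\<in>{0, 1}. \<forall>t\<in>{0..1}. v (t, s) \<noteq> 0 \<and> u (s, t) \<noteq> 0"
    have pos: "v (0, 0) * v (1, 0) > 0" "v (0, 1) * v (1, 1) > 0"
      "u (0, 0) * u (0, 1) > 0" "u (1, 0) * u (1, 1) > 0"
      using * by (intro horizontal_side_sign vertical_side_sign cont; simp)+
    have "(v (0, 0) * v (1, 0)) * (v (0, 1) * v (1, 1)) *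
      ((u (0, 0) * u (0, 1)) * (u (1, 0) * u (1, 1))) > 0"
      by (intro mult_pos_pos[OF mult_pos_pos mult_pos_pos] pos)
    then show ?thesis
      by (simp add: ac_simps)
  qed
  also have "\<dots> = k ^ 4 * (x (0, 0) * x (1, 0) * x (1, 1) * x (0, 1))"
  proof -
    have "\<dots> = (u (0, 0) * v (0, 0)) * (u (1, 0) * v (1, 0)) * (u (1, 1) * v (1, 1)) * (u (0, 1) * v (0, 1))"
      by (simp add: ac_simps)
    also have "\<dots> = (k * x (0, 0)) * (k * x (1, 0)) * (k * x (1, 1)) * (k * x (0, 1))"
      by (simp add: uv(2))
    finally show ?thesis
      by (simp add: power4_eq_xxxx ac_simps)
  qed
  finally show ?thesis
    using k(1) by (simp add: zero_less_mult_iff)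
qed

text \<open>The two products have equal squares, and opposite nonzero values would make the product
  over the four vertices negative. Foci are excluded only if \<open>a\<close> separates the
  subfamilies, so the assumption is vacuous for the other coefficients.\<close>

lemma coordinate_product:
  assumes "\<And>p. (a - \<mu> 0) * (a - \<nu> 0) < 0 \<Longrightarrow> p \<in> {0..1} \<times> {0..1} \<Longrightarrow> x p = 0 \<Longrightarrow>
      \<beta> * (y p)\<^sup>2 / (b - a) + \<gamma> * (z p)\<^sup>2 / (c - a) \<noteq> 0"
  shows "x (0, 0) * x (1, 1) = x (1, 0) * x (0, 1)"
proof (rule ccontr)
  assume "\<not> ?thesis"
  then have *: "x (0, 0) * x (1, 1) = - (x (1, 0) * x (0, 1))"
    using coordinate_square by (simp add: power2_eq_iff)
  have "(a - \<mu> 0) * (a - \<nu> 0) \<noteq> 0"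
    using \<mu>_neq[of 0] \<nu>_neq[of 0] by simp
  then have "x (0, 0) * x (1, 0) * x (1, 1) * x (0, 1) > 0"
    using sign_if_separating[OF _ assms] sign_if_not_separating by (metis linorder_neqE)
  also have "\<dots> = (x (0, 0) * x (1, 1)) * (x (1, 0) * x (0, 1))"
    by (simp add: ac_simps)
  also have "\<dots> = - ((x (1, 0) * x (0, 1))\<^sup>2)"
    unfolding * by (simp add: power2_eq_square)
  finally show False
    by (simp add: not_less)
qed

end

section \<open>Both geometries as instances of the sign argument\<close>

lemma net_quadrilateral_coordinate_products:
  assumes "net_quadrilateral M \<Lambda> K A B C D"
    and distinct: "a \<noteq> b" "b \<noteq> c" "a \<noteq> c" and sign: "\<alpha> * \<beta> * \<gamma> > 0"
    and \<Lambda>: "a \<notin> \<Lambda>" "b \<notin> \<Lambda>" "c \<notin> \<Lambda>"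
    and M: "\<And>P. P \<in> M \<Longrightarrow> \<alpha> * (P $ 1)\<^sup>2 + \<beta> * (P $ 2)\<^sup>2 + \<gamma> * (P $ 3)\<^sup>2 = 1"
    and K: "\<And>P l. P \<in> K l \<Longrightarrow>
      \<alpha> * (P $ 1)\<^sup>2 / (a - l) + \<beta> * (P $ 2)\<^sup>2 / (b - l) + \<gamma> * (P $ 3)\<^sup>2 / (c - l) = 0"
    and foci_a: "\<And>l m P. l \<in> \<Lambda> \<Longrightarrow> m \<in> \<Lambda> \<Longrightarrow> (a - l) * (a - m) < 0 \<Longrightarrow> P \<in> M \<Longrightarrow> P $ 1 = 0 \<Longrightarrow>
      \<beta> * (P $ 2)\<^sup>2 / (b - a) + \<gamma> * (P $ 3)\<^sup>2 / (c - a) \<noteq> 0"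
    and foci_b: "\<And>l m P. l \<in> \<Lambda> \<Longrightarrow> m \<in> \<Lambda> \<Longrightarrow> (b - l) * (b - m) < 0 \<Longrightarrow> P \<in> M \<Longrightarrow> P $ 2 = 0 \<Longrightarrow>
      \<gamma> * (P $ 3)\<^sup>2 / (c - b) + \<alpha> * (P $ 1)\<^sup>2 / (a - b) \<noteq> 0"
    and foci_c: "\<And>l m P. l \<in> \<Lambda> \<Longrightarrow> m \<in> \<Lambda> \<Longrightarrow> (c - l) * (c - m) < 0 \<Longrightarrow> P \<in> M \<Longrightarrow> P $ 3 = 0 \<Longrightarrow>
      \<alpha> * (P $ 1)\<^sup>2 / (a - c) + \<beta> * (P $ 2)\<^sup>2 / (b - c) \<noteq> 0"
  shows "A $ 1 * C $ 1 = B $ 1 * D $ 1 \<and> A $ 2 * C $ 2 = B $ 2 * D $ 2 \<and> A $ 3 * C $ 3 = B $ 3 * D $ 3"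
proof -
  obtain F :: "real \<times> real \<Rightarrow> real^3" and I J m0 m1 n0 n1 where F: "continuous_on ({0..1} \<times> {0..1}) F" "F ` ({0..1} \<times> {0..1}) \<subseteq> M"
      "F (0, 0) = A" "F (1, 0) = B" "F (1, 1) = C" "F (0, 1) = D"
    and sides: "F ` ({0..1} \<times> {0}) \<subseteq> K m0" "F ` ({0..1} \<times> {1}) \<subseteq> K m1"
      "F ` ({0} \<times> {0..1}) \<subseteq> K n0" "F ` ({1} \<times> {0..1}) \<subseteq> K n1"
    and IJ: "m0 \<in> I" "m1 \<in> I" "n0 \<in> J" "n1 \<in> J" "I \<in> components \<Lambda>" "J \<in> components \<Lambda>" "I \<noteq> J"
    using assms(1) unfolding net_quadrilateral_def by (elim exE conjE bexE) (rule that)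
  \<comment> \<open>Only the values at 0 and 1 matter; the fallback keeps every value in the right
    component.\<close>
  define \<mu> \<nu> where "\<mu> s = (if s = 0 then m0 else m1)" and "\<nu> s = (if s = 0 then n0 else n1)" for s :: real
  have mem: "\<mu> s \<in> I" "\<nu> s \<in> J" for s
    using IJ by (auto simp: \<mu>_def \<nu>_def)
  have "I \<inter> J = {}"
    using IJ components_nonoverlap by blast
  have FM: "F p \<in> M" if "p \<in> {0..1} \<times> {0..1}" for p
    using F(2) that by blast
  have FK: "F (t, s) \<in> K (\<mu> s)" "F (s, t) \<in> K (\<nu> s)" if "s \<in> {0, 1}" "t \<in> {0..1}" for s t
    using sides that by (auto simp: \<mu>_def \<nu>_def image_subset_iff)
  interpret xyz: confocal_square "\<lambda>p. F p $ 1" "\<lambda>p. F p $ 2" "\<lambda>p. F p $ 3" a b c \<alpha> \<beta> \<gamma> \<mu> \<nu>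
  proof
    show "(e - \<mu> s) * (e - \<mu> t) > 0" "(e - \<nu> s) * (e - \<nu> t) > 0" if "e \<in> {a, b, c}" for e s t
      using that \<Lambda> mem IJ(5,6) by (auto intro: components_same_side)
    show "\<mu> s \<noteq> \<nu> t" for s t
      using mem \<open>I \<inter> J = {}\<close> by (metis disjoint_iff)
  qed (use F(1) distinct sign M[OF FM] K[OF FK(1)] K[OF FK(2)] in \<open>auto intro!: continuous_intros\<close>)
  interpret yzx: confocal_square "\<lambda>p. F p $ 2" "\<lambda>p. F p $ 3" "\<lambda>p. F p $ 1" b c a \<beta> \<gamma> \<alpha> \<mu> \<nu>
    by (rule xyz.rotate)
  interpret zxy: confocal_square "\<lambda>p. F p $ 3" "\<lambda>p. F p $ 1" "\<lambda>p. F p $ 2" c a b \<gamma> \<alpha> \<beta> \<mu> \<nu>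
    by (rule yzx.rotate)
  have "\<mu> 0 \<in> \<Lambda>" "\<nu> 0 \<in> \<Lambda>"
    using mem IJ(5,6) in_components_subset by blast+
  then show ?thesis
    using xyz.coordinate_product[OF foci_a] yzx.coordinate_product[OF foci_b]
      zxy.coordinate_product[OF foci_c] FM F(3-6) by auto
qed

theorem theorem4:
  "(\<forall>(a::real) b c A B C D.
      a > b \<and> b > c \<and> spherical_conic_quadrilateral a b c A B C D \<longrightarrow>
      spherical_dist A C = spherical_dist B D) \<and>
   (\<forall>(a::real) b c A B C D.
      a \<noteq> b \<and> b \<noteq> c \<and> a \<noteq> c \<and> hyperbolic_conic_quadrilateral a b c A B C D \<longrightarrow>
      hyperbolic_dist A C = hyperbolic_dist B D)"
proof (intro conjI allI impI; elim conjE)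
  fix a b c :: real and A B C D
  assume abc: "b < a" "c < b" and quad: "spherical_conic_quadrilateral a b c A B C D"
  have sphere: "1 * (P $ 1)\<^sup>2 + 1 * (P $ 2)\<^sup>2 + 1 * (P $ 3)\<^sup>2 = 1" if "P \<in> sphere 0 1" for P :: "real^3"
    using that by (simp add: norm_eq_1 inner_vec_def sum_3 power2_eq_square)
  have "A $ 1 * C $ 1 = B $ 1 * D $ 1 \<and> A $ 2 * C $ 2 = B $ 2 * D $ 2 \<and> A $ 3 * C $ 3 = B $ 3 * D $ 3"
    using quad[unfolded spherical_conic_quadrilateral_def]
  proof (rule net_quadrilateral_coordinate_products[where a = a and b = b and c = c and \<alpha> = 1 and \<beta> = 1 and \<gamma> = 1])
    show "1 * (P $ 3)\<^sup>2 / (c - b) + 1 * (P $ 1)\<^sup>2 / (a - b) \<noteq> 0"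
      if "P \<in> sphere 0 1 - spherical_foci a b c" "P $ 2 = 0" for P
      using that by (auto simp: spherical_foci_def)
  \<comment> \<open>All parameters lie strictly between \<open>c\<close> and \<open>a\<close>, so
    only \<open>b\<close> can separate two of them.\<close>
  qed (use abc sphere in \<open>auto simp: spherical_conic_def mult_less_0_iff\<close>)
  then show "spherical_dist A C = spherical_dist B D"
    by (simp add: spherical_dist_def inner_vec_def sum_3)
next
  fix a b c :: real and A B C D
  assume abc: "a \<noteq> b" "b \<noteq> c" "a \<noteq> c" and quad: "hyperbolic_conic_quadrilateral a b c A B C D"
  have "A $ 1 * C $ 1 = B $ 1 * D $ 1 \<and> A $ 2 * C $ 2 = B $ 2 * D $ 2 \<and> A $ 3 * C $ 3 = B $ 3 * D $ 3"
    using quad[unfolded hyperbolic_conic_quadrilateral_def]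
  proof (rule net_quadrilateral_coordinate_products[where a = a and b = b and c = c and \<alpha> = "-1" and \<beta> = "-1" and \<gamma> = 1])
    show "- 1 * (P $ 1)\<^sup>2 + - 1 * (P $ 2)\<^sup>2 + 1 * (P $ 3)\<^sup>2 = 1"
      if "P \<in> hyperbolic_plane - hyperbolic_foci a b c" for P
      using that by (auto simp: hyperbolic_plane_def lorentz_def power2_eq_square)
  \<comment> \<open>The foci for \<open>a\<close> and \<open>b\<close> are removed from the surface,
    and \<open>z > 0\<close> rules out the plane belonging to \<open>c\<close>.\<close>
  qed (use abc in \<open>auto simp: hyperbolic_conic_def hyperbolic_foci_def hyperbolic_plane_def\<close>)
  then show "hyperbolic_dist A C = hyperbolic_dist B D"
    by (simp add: hyperbolic_dist_def lorentz_def)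
qed

end
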